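(* Let $\le$ be a binary relation on a set $S$ and let $\Pi$ be a (nonempty) subsemigroup of $(\mathrm{Endo}(S,\le),\circ)$. If $\le$ is $(\mathrm{id},\Pi)$-linear, then $\le$ is negatively $\Pi$-strict.
   Context: $\mathrm{Endo}(S,\le)$ is the set of all $f:S\to S$ such that $p\le q$ implies $f(p)\le f(q)$. $p<q$ means $p\le q$ and $q\nleq p$; $\nless$ is the negation of $<$. $\le$ is $(\mathrm{id},\Pi)$-linear if for all $p,q\in S$, either $p\le q$ or $\tau(q)\le\tau(p)$ for some $\tau\in\Pi$. $\le$ is negatively $\Pi$-strict if for all $p,q\in S$ with $p\nless q$ there is $\sigma\in\Pi$ such that $\tau(\sigma(p))\nless\tau(\sigma(q))$ for all $\tau\in\Pi$. *)

theory Defs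
  imports "HOL-Library.FuncSet"
begin

text \<open>
  A map from S to S is represented by an element of \<open>S \<rightarrow>\<^sub>E S\<close>, that is, it takes the value
  \<open>undefined\<close> outside S, so that equality of maps is equality of functions.
  Composition is accordingly \<open>compose S\<close>.
\<close>

definition Endo :: "'a set \<Rightarrow> 'a rel \<Rightarrow> ('a \<Rightarrow> 'a) set" where
  "Endo S le = {f \<in> S \<rightarrow>\<^sub>E S. \<forall>p\<in>S. \<forall>q\<in>S. (p, q) \<in> le \<longrightarrow> (f p, f q) \<in> le}"

definition subsemigroup_Endo :: "'a set \<Rightarrow> 'a rel \<Rightarrow> ('a \<Rightarrow> 'a) set \<Rightarrow> bool" where
  "subsemigroup_Endo S le P \<longleftrightarrow>
     P \<noteq> {} \<and> P \<subseteq> Endo S le \<and> (\<forall>\<sigma>\<in>P. \<forall>\<tau>\<in>P. compose S \<sigma> \<tau> \<in> P)"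

definition strict_rel :: "'a rel \<Rightarrow> 'a rel" where
  "strict_rel le = {(p, q). (p, q) \<in> le \<and> (q, p) \<notin> le}"

definition id_linear :: "'a set \<Rightarrow> 'a rel \<Rightarrow> ('a \<Rightarrow> 'a) set \<Rightarrow> bool" where
  "id_linear S le P \<longleftrightarrow>
     (\<forall>p\<in>S. \<forall>q\<in>S. (p, q) \<in> le \<or> (\<exists>\<tau>\<in>P. (\<tau> q, \<tau> p) \<in> le))"

definition negatively_strict :: "'a set \<Rightarrow> 'a rel \<Rightarrow> ('a \<Rightarrow> 'a) set \<Rightarrow> bool" where
  "negatively_strict S le P \<longleftrightarrow>
     (\<forall>p\<in>S. \<forall>q\<in>S. (p, q) \<notin> strict_rel le \<longrightarrow>
        (\<exists>\<sigma>\<in>P. \<forall>\<tau>\<in>P. (\<tau> (\<sigma> p), \<tau> (\<sigma> q)) \<notin> strict_rel le))"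

end

theory Submission
  imports Defs
begin

text \<open>The inequality p < q fails as soon as q \<le> p, and monotone maps preserve q \<le> p.
  So it suffices to find one \<sigma> in \<open>P\<close> with \<sigma>(q) \<le> \<sigma>(p): every
  \<tau> in \<open>P\<close> then carries this to \<tau>(\<sigma>(q)) \<le> \<tau>(\<sigma>(p)),
  which rules out the strict inequality. Linearity supplies \<sigma> unless q \<le> p already
  holds.\<close>

theorem proposition4p13:
  fixes S :: "'a set" and le :: "'a rel" and P :: "('a \<Rightarrow> 'a) set"
  assumes "le \<subseteq> S \<times> S"
    and "subsemigroup_Endo S le P"
    and "id_linear S le P"
  shows "negatively_strict S le P"
  unfolding negatively_strict_def
proof (intro ballI impI)
  fix p q
  assume p: "p \<in> S" and q: "q \<in> S" and not_less: "(p, q) \<notin> strict_rel le"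
  have "P \<noteq> {}" and P: "P \<subseteq> Endo S le"
    using assms(2) by (auto simp: subsemigroup_Endo_def)
  have mono: "(\<tau> x, \<tau> y) \<in> le" if "\<tau> \<in> P" "x \<in> S" "y \<in> S" "(x, y) \<in> le" for \<tau> x y
    using P that by (auto simp: Endo_def)
  have closed: "\<tau> x \<in> S" if "\<tau> \<in> P" "x \<in> S" for \<tau> x
    using P that by (auto simp: Endo_def)
  obtain \<sigma> where \<sigma>: "\<sigma> \<in> P" "(\<sigma> q, \<sigma> p) \<in> le"
  proof (cases "(q, p) \<in> le")
    case True
    \<comment> \<open>Any element of the nonempty \<open>P\<close> serves, by monotonicity.\<close>
    then show ?thesis
      using \<open>P \<noteq> {}\<close> mono p q that by blast
  next
    case False
    \<comment> \<open>Here p \<le> q would be strict, against \<open>not_less\<close>; so linearity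
      at (p, q) must give its second alternative.\<close>
    then have "(p, q) \<notin> le"
      using not_less by (simp add: strict_rel_def)
    then show ?thesis
      using assms(3) p q that by (auto simp: id_linear_def)
  qed
  \<comment> \<open>\<open>closed\<close> keeps \<sigma>(p) and \<sigma>(q) in \<open>S\<close>,
    where \<tau> is monotone.\<close>
  have "(\<tau> (\<sigma> p), \<tau> (\<sigma> q)) \<notin> strict_rel le" if "\<tau> \<in> P" for \<tau>
    using mono[OF that closed closed] \<sigma> p q by (simp add: strict_rel_def)
  then show "\<exists>\<sigma>\<in>P. \<forall>\<tau>\<in>P. (\<tau> (\<sigma> p), \<tau> (\<sigma> q)) \<notin> strict_rel le"
    using \<sigma>(1) by blast
qed

end
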